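(* Let $\mathcal{R}$ be a commutative Frobenius ring, let $n$ be a positive integer, and let $\lambda\in\mathcal{R}$ satisfy $\lambda^{2}=1$. Let $A,B,C,D$ be $n\times n$ $\lambda$-circulant matrices over $\mathcal{R}$ satisfying $$AA^{T}+BB^{T}+CC^{T}+DD^{T}=-I_{n},$$ $$AB^{T}-BA^{T}=0,$$ and $$CD^{T}-DC^{T}=0.$$ Let $\mathcal{C}$ be the linear code over $\mathcal{R}$ of length $8n$ generated by (the rows of) the $4n\times 8n$ matrix $$G=\left(\; I_{4n}\;\left|\;\begin{array}{cccc} A & B & C & D \\ -B & A & -D & C \\ -C^{T} & D^{T} & A^{T} & -B^{T} \\ -D^{T} & -C^{T} & B^{T} & A^{T}\end{array}\right.\right).$$ Then $\mathcal{C}$ is self-dual.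
   Context: Rings are finite, commutative, with identity. A linear code of length $m$ over a ring $\mathcal{R}$ is an $\mathcal{R}$-submodule of $\mathcal{R}^{m}$. The inner product on $\mathcal{R}^{m}$ is $\langle \mathbf{u},\mathbf{v}\rangle=\sum_{i=1}^{m}u_iv_i$. The dual of a code $\mathcal{C}\subseteq\mathcal{R}^{m}$ is $\mathcal{C}^{\perp}=\{\mathbf{v}\in\mathcal{R}^{m}\mid \langle\mathbf{u},\mathbf{v}\rangle=0\text{ for all }\mathbf{u}\in\mathcal{C}\}$, and $\mathcal{C}$ is self-dual if $\mathcal{C}=\mathcal{C}^{\perp}$. For $\lambda\in\mathcal{R}$, the $\lambda$-circular shift is $\sigma_\lambda(a_1,a_2,\dots,a_n)=(\lambda a_n,a_1,\dots,a_{n-1})$. An $n\times n$ matrix over $\mathcal{R}$ is $\lambda$-circulant if its rows are, in order, $\overline{r},\sigma_\lambda(\overline{r}),\sigma_\lambda^2(\overline{r}),\dots,\sigma_\lambda^{n-1}(\overline{r})$, where $\overline{r}\in\mathcal{R}^n$ is its first row. $M^T$ denotes the transpose of $M$ and $I_k$ the $k\times k$ identity matrix. *)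

theory Defs
  imports "Jordan_Normal_Form.VS_Connect" "HOL-Algebra.QuotRing"
begin

section \<open>Finite commutative Frobenius rings\<close>

definition jacobson_radical :: "('a, 'b) ring_scheme \<Rightarrow> 'a set" where
  "jacobson_radical R = carrier R \<inter> \<Inter>{M. maximalideal M R}"

definition minimal_ideal :: "'a set \<Rightarrow> ('a, 'b) ring_scheme \<Rightarrow> bool" where
  "minimal_ideal I R \<longleftrightarrow>
     ideal I R \<and> I \<noteq> {\<zero>\<^bsub>R\<^esub>} \<and> (\<forall>J. ideal J R \<longrightarrow> J \<subseteq> I \<longrightarrow> J = {\<zero>\<^bsub>R\<^esub>} \<or> J = I)"

text \<open>The sum of the minimal ideals, i.e. the socle of a commutative ring as a module over itself.\<close>
definition socle :: "('a, 'b) ring_scheme \<Rightarrow> 'a set" where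
  "socle R = Idl\<^bsub>R\<^esub> (\<Union>{I. minimal_ideal I R})"

text \<open>
  A module record extends a ring record; its multiplicative components are irrelevant and
  left undefined.
\<close>
definition ideal_module :: "('a, 'b) ring_scheme \<Rightarrow> 'a set \<Rightarrow> ('a, 'a) module" where
  "ideal_module R I =
     \<lparr>carrier = I, mult = undefined, one = undefined,
      zero = \<zero>\<^bsub>R\<^esub>, add = (\<oplus>\<^bsub>R\<^esub>), smult = (\<otimes>\<^bsub>R\<^esub>)\<rparr>"

definition quotient_module :: "('a, 'b) ring_scheme \<Rightarrow> 'a set \<Rightarrow> ('a, 'a set) module" where
  "quotient_module R I =
     \<lparr>carrier = carrier (R Quot I), mult = undefined, one = undefined,
      zero = \<zero>\<^bsub>R Quot I\<^esub>, add = (\<oplus>\<^bsub>R Quot I\<^esub>),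
      smult = (\<lambda>r X. (I +>\<^bsub>R\<^esub> r) \<otimes>\<^bsub>R Quot I\<^esub> X)\<rparr>"

definition modules_iso ::
  "('r, 'q) ring_scheme \<Rightarrow> ('r, 'a, 'c) module_scheme \<Rightarrow> ('r, 'b, 'd) module_scheme \<Rightarrow> bool" where
  "modules_iso R M N \<longleftrightarrow>
     (\<exists>f. mod_hom R M N f \<and> bij_betw f (carrier M) (carrier N))"

text \<open>
  The ring-theoretic definition: a finite commutative ring \<open>R\<close> with Jacobson radical \<open>J\<close> is
  Frobenius if \<open>R / J\<close> and the socle of \<open>R\<close> are isomorphic as \<open>R\<close>-modules.
\<close>
definition finite_frobenius_cring :: "('a, 'b) ring_scheme \<Rightarrow> bool" where
  "finite_frobenius_cring R \<longleftrightarrow>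
     cring R \<and> finite (carrier R) \<and>
     modules_iso R (quotient_module R (jacobson_radical R)) (ideal_module R (socle R))"


section \<open>Linear codes\<close>

definition linear_code :: "nat \<Rightarrow> 'a::comm_ring_1 vec set \<Rightarrow> bool" where
  "linear_code m C \<longleftrightarrow> LinearCombinations.submodule (class_ring :: 'a ring) C (module_vec TYPE('a) m)"

definition generated_code :: "'a::comm_ring_1 mat \<Rightarrow> 'a vec set" where
  "generated_code G =
     LinearCombinations.module.span (class_ring :: 'a ring) (module_vec TYPE('a) (dim_col G))
       (set (rows G))"

definition dual_code :: "nat \<Rightarrow> 'a::comm_ring_1 vec set \<Rightarrow> 'a vec set" where
  "dual_code m C = {v \<in> carrier_vec m. \<forall>u \<in> C. u \<bullet> v = 0}"

definition self_dual :: "nat \<Rightarrow> 'a::comm_ring_1 vec set \<Rightarrow> bool" where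
  "self_dual m C \<longleftrightarrow> linear_code m C \<and> C = dual_code m C"


section \<open>Circulant matrices and the generator matrix\<close>

definition circular_shift :: "'a::comm_ring_1 \<Rightarrow> 'a vec \<Rightarrow> 'a vec" where
  "circular_shift l v =
     vec (dim_vec v) (\<lambda>i. if i = 0 then l * v $ (dim_vec v - 1) else v $ (i - 1))"

definition circulant :: "'a::comm_ring_1 \<Rightarrow> nat \<Rightarrow> 'a mat \<Rightarrow> bool" where
  "circulant l n A \<longleftrightarrow>
     A \<in> carrier_mat n n \<and>
     (\<exists>r \<in> carrier_vec n. \<forall>i < n. row A i = (circular_shift l ^^ i) r)"

text \<open>The counterpart of \<^const>\<open>append_rows\<close>: the block matrix \<open>(A | B)\<close>.\<close>
definition append_cols :: "'a::zero mat \<Rightarrow> 'a mat \<Rightarrow> 'a mat" where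
  "append_cols A B = four_block_mat A B (0\<^sub>m 0 (dim_col A)) (0\<^sub>m 0 (dim_col B))"

text \<open>The \<open>4 \<times> 4\<close> array of \<open>n \<times> n\<close> blocks is grouped into four \<open>2 \<times> 2\<close> arrays.\<close>
definition generator_matrix ::
  "nat \<Rightarrow> 'a::comm_ring_1 mat \<Rightarrow> 'a mat \<Rightarrow> 'a mat \<Rightarrow> 'a mat \<Rightarrow> 'a mat" where
  "generator_matrix n A B C D =
     append_cols (1\<^sub>m (4 * n))
       (four_block_mat
          (four_block_mat   A      B
                          (- B)    A  )
          (four_block_mat   C      D
                          (- D)    C  )
          (four_block_mat (- C\<^sup>T)  (D\<^sup>T)
                          (- D\<^sup>T) (- C\<^sup>T))
          (four_block_mat  (A\<^sup>T)  (- B\<^sup>T)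
                           (B\<^sup>T)   (A\<^sup>T)))"

end

theory Submission
  imports Defs "Jordan_Normal_Form.Determinant"
begin

text \<open>
  Write the generator matrix as \<open>G = (I | X)\<close>. Everything reduces to the single identity
  \<open>X X\<^sup>T = - I\<close>. It says that \<open>G G\<^sup>T = I + X X\<^sup>T = 0\<close>, so the code is contained in its dual. Over a
  commutative ring it also gives \<open>X\<^sup>T X = - I\<close>, and that yields the other inclusion: a
  vector \<open>(a, b)\<close> of the dual satisfies \<open>a = - X b\<close>, hence \<open>X\<^sup>T a = b\<close>, so that
  \<open>(a, b) = (a, X\<^sup>T a)\<close> is the combination of the rows of \<open>G\<close> with coefficients \<open>a\<close>
  (\<open>self_dual_standard_form\<close>).

  The identity comes from a quaternionic structure of \<open>X\<close>. Put \<open>P = (A, B; - B, A)\<close> and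
  \<open>Q = (C, D; - D, C)\<close>, which are the matrix forms of \<open>A + i B\<close> and \<open>C + i D\<close> for a
  formal imaginary unit \<open>i\<close>. Then \<open>X = (P, Q; - Q\<^sup>T, P\<^sup>T)\<close>, the usual matrix form of a quaternion. For commuting
  normal blocks \<open>P\<close> and \<open>Q\<close> the product \<open>X X\<^sup>T\<close> is block diagonal with both blocks equal to
  \<open>P P\<^sup>T + Q Q\<^sup>T\<close> (\<open>quaternion_block_orthogonal\<close>). The two symmetry hypotheses say that the
  imaginary parts of \<open>P P\<^sup>T\<close> and \<open>Q Q\<^sup>T\<close> vanish, and the norm hypothesis that their real parts add
  up to \<open>- I\<close>.

  It remains to see that \<open>P\<close> and \<open>Q\<close> are normal and commute. This holds because
  \<open>\<lambda>\<close>-circulant matrices commute with each other and, as \<open>\<lambda>\<^sup>2 = 1\<close>, with each other's transposes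
  (\<open>circulants_commute\<close>).
\<close>

section \<open>Codes given by a generator matrix\<close>

text \<open>
  This replaces the span, whose linear combinations range over the set of rows and so do not see
  repeated rows, by the image of a matrix, on which the rest of the argument computes.
\<close>
lemma generated_code_eq_range:
  assumes G: "(G :: 'a::comm_ring_1 mat) \<in> carrier_mat k m"
  shows "generated_code G = (\<lambda>x. G\<^sup>T *\<^sub>v x) ` carrier_vec k"
proof -
  interpret vec_module "TYPE('a)" m .
  have rows: "set (rows G) \<subseteq> carrier_vec m" and len: "length (rows G) = k"
    using G by (auto simp: rows_def)
  have GT: "mat_of_cols m (rows G) = G\<^sup>T"
    using G by (auto intro!: eq_matI simp: mat_of_cols_index)
  have span: "generated_code G = range (\<lambda>a. lincomb a (set (rows G)))"
    using G finite_span[OF _ rows] by (auto simp: generated_code_def)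
  show ?thesis
  proof (intro equalityI subsetI)
    fix v assume "v \<in> generated_code G"
    then obtain a where "v = lincomb a (set (rows G))"
      using span by auto
    then obtain c where "v = lincomb_list c (rows G)"
      using lincomb_as_lincomb_list[OF rows] by blast
    also have "\<dots> = G\<^sup>T *\<^sub>v vec k c"
      using lincomb_list_as_mat_mult[of "rows G" c] rows GT len by fastforce
    finally show "v \<in> (\<lambda>x. G\<^sup>T *\<^sub>v x) ` carrier_vec k"
      by auto
  next
    fix v assume "v \<in> (\<lambda>x. G\<^sup>T *\<^sub>v x) ` carrier_vec k"
    then obtain x where x: "x \<in> carrier_vec k" "v = G\<^sup>T *\<^sub>v x" by auto
    have "\<exists>a. mat_of_cols m (rows G) *\<^sub>v x = lincomb a (set (rows G))"
      using mat_of_cols_mult_as_finsum[of x "rows G"] rows len x(1) by (metis nth_mem subsetD)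
    then have "v \<in> range (\<lambda>a. lincomb a (set (rows G)))"
      using x(2) GT by auto
    then show "v \<in> generated_code G" using span by simp
  qed
qed

lemma linear_code_generated_code:
  assumes G: "(G :: 'a::comm_ring_1 mat) \<in> carrier_mat k m"
  shows "linear_code m (generated_code G)"
proof -
  interpret vec_module "TYPE('a)" m .
  have "set (rows G) \<subseteq> carrier_vec m" using G by (auto simp: rows_def)
  from span_is_submodule[OF this] show ?thesis
    using G by (simp add: linear_code_def generated_code_def)
qed

text \<open>
  The transpose is adjoint to \<open>G\<close> for the inner product, so \<open>v\<close> is orthogonal to all \<open>G\<^sup>T x\<close> exactly
  if \<open>G v\<close> is orthogonal to every \<open>x\<close>; unit vectors \<open>x\<close> then detect each entry of \<open>G v\<close>.
\<close>
lemma dual_generated_code: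
  assumes G: "(G :: 'a::comm_ring_1 mat) \<in> carrier_mat k m"
  shows "dual_code m (generated_code G) = {v \<in> carrier_vec m. G *\<^sub>v v = 0\<^sub>v k}"
proof -
  have adj: "(G\<^sup>T *\<^sub>v x) \<bullet> v = x \<bullet> (G *\<^sub>v v)"
    if "x \<in> carrier_vec k" "v \<in> carrier_vec m" for x v
    using transpose_vec_mult_scalar[OF G that(2,1)] .
  have "G *\<^sub>v v = 0\<^sub>v k" if v: "v \<in> dual_code m (generated_code G)" for v
  proof (rule eq_vecI)
    fix i assume "i < dim_vec (0\<^sub>v k :: 'a vec)"
    then have i: "i < k" by simp
    have vm: "v \<in> carrier_vec m" using v by (simp add: dual_code_def)
    have Gv: "G *\<^sub>v v \<in> carrier_vec k" using mult_mat_vec_carrier[OF G vm] .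
    have "0 = unit_vec k i \<bullet> (G *\<^sub>v v)"
      using v adj[OF _ vm, of "unit_vec k i"]
      by (force simp: dual_code_def generated_code_eq_range[OF G])
    also have "\<dots> = (G *\<^sub>v v) $ i" using i Gv by simp
    finally show "(G *\<^sub>v v) $ i = 0\<^sub>v k $ i" using i by simp
  qed (use G in simp)
  moreover have "v \<in> dual_code m (generated_code G)"
    if "v \<in> carrier_vec m" "G *\<^sub>v v = 0\<^sub>v k" for v
    using that by (auto simp: dual_code_def generated_code_eq_range[OF G] adj)
  ultimately show ?thesis
    by (auto simp: dual_code_def)
qed

text \<open>
  The determinant of \<open>A\<close> is a unit with inverse \<open>det B\<close>. Multiplying \<open>A B = I\<close> by the adjugate shows
  that the adjugate of \<open>A\<close> is \<open>det A\<close> times \<open>B\<close>, so the adjugate identity reads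
  \<open>det A (B A) = det A I\<close>, where \<open>det A\<close> may be cancelled.
\<close>
lemma right_inverse_imp_left_inverse:
  fixes A :: "'a::comm_ring_1 mat"
  assumes A: "A \<in> carrier_mat n n" and B: "B \<in> carrier_mat n n" and AB: "A * B = 1\<^sub>m n"
  shows "B * A = 1\<^sub>m n"
proof -
  note adj = adj_mat[OF A]
  have dets: "det B * det A = 1"
    using det_mult[OF A B] AB by (simp add: mult.commute)
  have "adj_mat A = adj_mat A * (A * B)" using adj(1) AB by simp
  also have "\<dots> = (adj_mat A * A) * B" using assoc_mult_mat[OF adj(1) A B] by simp
  also have "\<dots> = det A \<cdot>\<^sub>m B"
    using adj(3) B by (simp add: mult_smult_assoc_mat[of _ n n])
  finally have adjA: "adj_mat A = det A \<cdot>\<^sub>m B" .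
  have "det A \<cdot>\<^sub>m (B * A) = det A \<cdot>\<^sub>m 1\<^sub>m n"
    using adj(3) A B unfolding adjA by (simp add: mult_smult_assoc_mat[of _ n n])
  then have "(det B * det A) \<cdot>\<^sub>m (B * A) = (det B * det A) \<cdot>\<^sub>m 1\<^sub>m n"
    using A B by (auto simp: mat_eq_iff mult.assoc)
  then have "1 \<cdot>\<^sub>m (B * A) = 1 \<cdot>\<^sub>m 1\<^sub>m n"
    unfolding dets .
  moreover have "1 \<cdot>\<^sub>m M = M" for M :: "'a mat"
    by (rule eq_matI) simp_all
  ultimately show ?thesis by simp
qed

text \<open>
  Row orthogonality of \<open>X\<close> makes the code self-orthogonal; column orthogonality makes it as large
  as its dual.
\<close>
lemma self_dual_standard_form:
  fixes X :: "'a::comm_ring_1 mat"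
  assumes X: "X \<in> carrier_mat k k" and orth: "X * X\<^sup>T = - 1\<^sub>m k"
  shows "self_dual (2 * k) (generated_code (append_cols (1\<^sub>m k) X))"
proof -
  define G where "G = append_cols (1\<^sub>m k) X"
  have G: "G \<in> carrier_mat k (2 * k)"
    using X by (auto simp: G_def append_cols_def)
  have orth': "X\<^sup>T * X = - 1\<^sub>m k"
  proof -
    have "X * (- X\<^sup>T) = 1\<^sub>m k"
      using X orth by (simp add: uminus_mult_right_mat)
    from right_inverse_imp_left_inverse[OF X _ this] X
    have "- X\<^sup>T * X = 1\<^sub>m k" by simp
    then show ?thesis using X
      by (metis carrier_matD(1) index_transpose_mat(3) uminus_mult_left_mat uminus_uminus_mat)
  qed
  have mult: "G *\<^sub>v (a @\<^sub>v b) = a + X *\<^sub>v b"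
    if "a \<in> carrier_vec k" "b \<in> carrier_vec k" for a b
    unfolding G_def append_cols_def using that X
    by (subst four_block_mat_mult_vec[of _ k k _ k _ 0]) auto
  have multT: "G\<^sup>T *\<^sub>v x = x @\<^sub>v (X\<^sup>T *\<^sub>v x)" if "x \<in> carrier_vec k" for x
  proof -
    have "G\<^sup>T = 1\<^sub>m k @\<^sub>r X\<^sup>T"
      using X by (auto intro!: eq_matI simp: G_def append_cols_def append_rows_def)
    then show ?thesis
      using mat_mult_append[of "1\<^sub>m k" k k "X\<^sup>T" k x] that X by simp
  qed
  have "generated_code G = dual_code (2 * k) (generated_code G)"
    unfolding dual_generated_code[OF G] unfolding generated_code_eq_range[OF G]
  proof (intro equalityI subsetI)
    fix v assume "v \<in> (\<lambda>x. G\<^sup>T *\<^sub>v x) ` carrier_vec k"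
    then obtain x where x: "x \<in> carrier_vec k" and v: "v = G\<^sup>T *\<^sub>v x" by auto
    have "G *\<^sub>v v = x + X *\<^sub>v (X\<^sup>T *\<^sub>v x)"
      unfolding v multT[OF x] using mult x X by simp
    also have "\<dots> = x + - 1\<^sub>m k *\<^sub>v x"
      using assoc_mult_mat_vec[of X k k "X\<^sup>T" k x] X x orth by simp
    also have "\<dots> = 0\<^sub>v k" using x by simp
    finally show "v \<in> {v \<in> carrier_vec (2 * k). G *\<^sub>v v = 0\<^sub>v k}"
      using G x v by simp
  next
    fix v assume "v \<in> {v \<in> carrier_vec (2 * k). G *\<^sub>v v = 0\<^sub>v k}"
    then have v: "v \<in> carrier_vec (k + k)" and Gv: "G *\<^sub>v v = 0\<^sub>v k"
      by (auto simp: mult_2)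
    define a b where "a = vec_first v k" and "b = vec_last v k"
    have a: "a \<in> carrier_vec k" and b: "b \<in> carrier_vec k"
      by (auto simp: a_def b_def)
    have ab: "v = a @\<^sub>v b" using v by (simp add: a_def b_def)
    have "a + X *\<^sub>v b = 0\<^sub>v k"
      using Gv mult[OF a b] by (simp add: ab)
    moreover have zero: "X\<^sup>T *\<^sub>v 0\<^sub>v k = 0\<^sub>v k"
      using X by (intro eq_vecI) auto
    ultimately have "X\<^sup>T *\<^sub>v a + (X\<^sup>T * X) *\<^sub>v b = 0\<^sub>v k"
      using X a b by (simp add: zero flip: mult_add_distrib_mat_vec[of _ k k])
    then have "X\<^sup>T *\<^sub>v a - b = 0\<^sub>v k"
      using X a b by (simp add: orth' minus_add_uminus_vec[of _ k])
    then have "X\<^sup>T *\<^sub>v a = b"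
      using X a b by (simp add: vec_eq_iff)
    then have "v = G\<^sup>T *\<^sub>v a" using ab multT[OF a] by simp
    then show "v \<in> (\<lambda>x. G\<^sup>T *\<^sub>v x) ` carrier_vec k" using a by auto
  qed
  then show ?thesis
    using linear_code_generated_code[OF G] by (simp add: self_dual_def G_def)
qed

section \<open>Circulant matrices commute\<close>

definition toeplitz_mat :: "nat \<Rightarrow> (int \<Rightarrow> 'a) \<Rightarrow> 'a mat" where
  "toeplitz_mat n a = mat n n (\<lambda>(i, j). a (int j - int i))"

text \<open>
  The symbol of a Toeplitz matrix lives on all of the integers, so that index arithmetic modulo \<open>n\<close>
  becomes a functional equation and the wrap-around in a circulant needs no case distinction.
\<close>
definition twisted_periodic :: "'a::comm_ring_1 \<Rightarrow> nat \<Rightarrow> (int \<Rightarrow> 'a) \<Rightarrow> bool" where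
  "twisted_periodic l n a \<longleftrightarrow> (\<forall>m. a (m + int n) = l * a m)"

text \<open>
  The symbol is the first row, extended to the integers with one factor \<open>l\<close> for each step of
  length \<open>n\<close>. Since \<open>l\<^sup>2 = 1\<close>, only the parity of the number of steps matters, which also
  makes sense for steps to the left.
\<close>
lemma circulant_imp_toeplitz:
  fixes A :: "'a::comm_ring_1 mat"
  assumes n: "n > 0" and l: "l ^ 2 = 1" and A: "circulant l n A"
  obtains a where "twisted_periodic l n a" "A = toeplitz_mat n a"
proof -
  from A obtain r where r: "r \<in> carrier_vec n" and A_carr: "A \<in> carrier_mat n n"
    and row: "\<And>i. i < n \<Longrightarrow> row A i = (circular_shift l ^^ i) r"
    unfolding circulant_def by auto
  define a where "a m = (if even (m div int n) then 1 else l) * r $ nat (m mod int n)" for m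
  have ll: "l * (l * x) = x" for x
    using l by (simp add: power2_eq_square flip: mult.assoc)
  have per: "a (m + int n) = l * a m" for m
    using n by (simp add: a_def ll)
  have shift: "(circular_shift l ^^ i) r = vec n (\<lambda>j. a (int j - int i))" for i
  proof (induction i)
    case 0
    show ?case using r by (intro eq_vecI) (auto simp: a_def)
  next
    case (Suc i)
    \<comment> \<open>The entry that wraps around to column \<open>0\<close>: going back by \<open>n\<close> costs the inverse of \<open>l\<close>, which is \<open>l\<close>.\<close>
    have "a (- 1 - int i) = l * a (int n - 1 - int i)"
      using per[of "- 1 - int i"] by (simp add: ll algebra_simps)
    then show ?case
      unfolding funpow.simps o_apply Suc.IH
      by (intro eq_vecI) (auto simp: circular_shift_def of_nat_diff algebra_simps)
  qed
  have "A = toeplitz_mat n a"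
  proof (rule eq_matI)
    fix i j assume "i < dim_row (toeplitz_mat n a)" "j < dim_col (toeplitz_mat n a)"
    then have ij: "i < n" "j < n" by (auto simp: toeplitz_mat_def)
    have "A $$ (i, j) = row A i $ j" using A_carr ij by simp
    then show "A $$ (i, j) = toeplitz_mat n a $$ (i, j)"
      using ij by (simp add: row shift toeplitz_mat_def)
  qed (use A_carr in \<open>auto simp: toeplitz_mat_def\<close>)
  with per that show thesis by (auto simp: twisted_periodic_def)
qed

text \<open>The reflection \<open>j \<mapsto> c - j\<close> permutes the residues modulo \<open>n\<close>.\<close>
lemma sum_periodic_reflect:
  fixes f :: "int \<Rightarrow> 'b::comm_monoid_add"
  assumes n: "n > 0" and per: "\<And>m. f (m + int n) = f m"
  shows "(\<Sum>j<n. f (c - int j)) = (\<Sum>j<n. f (int j))"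
proof -
  have mult: "f (m + int k * int n) = f m" for m k
  proof (induction k)
    case (Suc k)
    then show ?case using per[of "m + int k * int n"] by (simp add: algebra_simps)
  qed simp
  have multi: "f (m + k * int n) = f m" for m k
    using mult[of m "nat k"] mult[of "m + k * int n" "nat (- k)"] by (cases "k \<ge> 0") auto
  have per': "f (m mod int n) = f m" for m
    using multi[of "m mod int n" "m div int n"] by simp
  define g where "g j = nat ((c - int j) mod int n)" for j
  have g: "int (g j) = (c - int j) mod int n" for j using n by (simp add: g_def)
  have gg: "g (g j) = j" if "j < n" for j
  proof -
    have "int (g (g j)) = (c - (c - int j)) mod int n"
      unfolding g by (simp only: mod_diff_right_eq)
    then show ?thesis using that by simp
  qed
  have gl: "g j < n" for j using n by (simp add: g_def nat_less_iff)
  show ?thesis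
    by (rule sum.reindex_bij_witness[of _ g g]) (auto simp: gg gl g per')
qed

text \<open>
  The \<open>(i, k)\<close> entry of the product is the sum of \<open>a (j - i) b (k - j)\<close> over \<open>j\<close>. Moving \<open>j\<close> by \<open>n\<close>
  multiplies each of the two factors by \<open>l\<close>, so by \<open>l\<^sup>2 = 1\<close> the summand is periodic, and the
  reflection \<open>j \<mapsto> i + k - j\<close> exchanges the roles of \<open>a\<close> and \<open>b\<close>.
\<close>
lemma toeplitz_mat_commute:
  fixes a b :: "int \<Rightarrow> 'a::comm_ring_1"
  assumes n: "n > 0" and l: "l ^ 2 = 1"
    and a: "twisted_periodic l n a" and b: "twisted_periodic l n b"
  shows "toeplitz_mat n a * toeplitz_mat n b = toeplitz_mat n b * toeplitz_mat n a"
proof (rule eq_matI)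
  fix i k assume "i < dim_row (toeplitz_mat n b * toeplitz_mat n a)"
    and "k < dim_col (toeplitz_mat n b * toeplitz_mat n a)"
  then have ik: "i < n" "k < n" by (auto simp: toeplitz_mat_def)
  define f where "f j = a (j - int i) * b (int k - j)" for j
  have per: "f (j + int n) = f j" for j
  proof -
    have "a (j - int i + int n) = l * a (j - int i)"
      "b (int k - j) = l * b (int k - j - int n)"
      using a b[unfolded twisted_periodic_def, rule_format, of "int k - j - int n"]
      by (auto simp: twisted_periodic_def)
    then show ?thesis by (simp add: f_def algebra_simps)
  qed
  have "(toeplitz_mat n a * toeplitz_mat n b) $$ (i, k) = (\<Sum>j<n. f (int j))"
    using ik by (simp add: toeplitz_mat_def scalar_prod_def f_def lessThan_atLeast0)
  also have "\<dots> = (\<Sum>j<n. f (int i + int k - int j))"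
    using sum_periodic_reflect[of n f "int i + int k", OF n per] by simp
  also have "\<dots> = (toeplitz_mat n b * toeplitz_mat n a) $$ (i, k)"
    using ik by (simp add: toeplitz_mat_def scalar_prod_def f_def lessThan_atLeast0 mult.commute)
  finally show "(toeplitz_mat n a * toeplitz_mat n b) $$ (i, k)
    = (toeplitz_mat n b * toeplitz_mat n a) $$ (i, k)" .
qed (auto simp: toeplitz_mat_def)

text \<open>
  Reflection turns the twist \<open>l\<close> into its inverse, which is \<open>l\<close> again; with the next lemma this is why
  the transpose of a circulant has the same twist.
\<close>
lemma twisted_periodic_reflect:
  assumes "l ^ 2 = 1" "twisted_periodic l n a"
  shows "twisted_periodic l n (\<lambda>m. a (- m))"
  unfolding twisted_periodic_def
proof
  fix m
  have "a (- m) = l * a (- m - int n)"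
    using assms(2)[unfolded twisted_periodic_def, rule_format, of "- m - int n"] by simp
  then show "a (- (m + int n)) = l * a (- m)"
    using assms(1) by (simp add: power2_eq_square flip: mult.assoc)
qed

lemma transpose_toeplitz_mat: "(toeplitz_mat n a)\<^sup>T = toeplitz_mat n (\<lambda>m. a (- m))"
  by (rule eq_matI) (auto simp: toeplitz_mat_def)

lemma circulants_commute:
  fixes A B :: "'a::comm_ring_1 mat"
  assumes "n > 0" "l ^ 2 = 1" "circulant l n A" "circulant l n B"
  shows "A * B = B * A" and "A * B\<^sup>T = B\<^sup>T * A"
proof -
  obtain a b where a: "twisted_periodic l n a" "A = toeplitz_mat n a"
    and b: "twisted_periodic l n b" "B = toeplitz_mat n b"
    using assms by (metis circulant_imp_toeplitz)
  note comm = toeplitz_mat_commute[OF assms(1,2)] and refl = twisted_periodic_reflect[OF assms(2)]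
  show "A * B = B * A" "A * B\<^sup>T = B\<^sup>T * A"
    unfolding a(2) b(2) transpose_toeplitz_mat
    by (intro comm refl a(1) b(1))+
qed

section \<open>Complex and quaternionic block matrices\<close>

text \<open>The matrix form of \<open>A + i B\<close> with a formal imaginary unit \<open>i\<close>; it respects sums and products.\<close>
definition complex_block :: "'a::comm_ring_1 mat \<Rightarrow> 'a mat \<Rightarrow> 'a mat" where
  "complex_block A B = four_block_mat A B (- B) A"

lemma complex_block_carrier:
  "A \<in> carrier_mat n n \<Longrightarrow> complex_block A B \<in> carrier_mat (n + n) (n + n)"
  by (simp add: complex_block_def)

lemma complex_block_mult:
  fixes A B C D :: "'a::comm_ring_1 mat"
  assumes "A \<in> carrier_mat n n" "B \<in> carrier_mat n n" "C \<in> carrier_mat n n" "D \<in> carrier_mat n n"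
  shows "complex_block A B * complex_block C D = complex_block (A * C - B * D) (A * D + B * C)"
  unfolding complex_block_def
  using assms
  by (subst mult_four_block_mat[of _ n n _ n _ n _ _ n _ n])
    (auto intro!: cong_four_block_mat eq_matI
       simp: scalar_prod_def sum_negf)

lemma complex_block_add:
  fixes A B C D :: "'a::comm_ring_1 mat"
  assumes "A \<in> carrier_mat n n" "B \<in> carrier_mat n n" "C \<in> carrier_mat n n" "D \<in> carrier_mat n n"
  shows "complex_block A B + complex_block C D = complex_block (A + C) (B + D)"
  unfolding complex_block_def
  using assms by (intro eq_matI) auto

lemma transpose_complex_block:
  fixes A B :: "'a::comm_ring_1 mat"
  assumes "A \<in> carrier_mat n n" "B \<in> carrier_mat n n"
  shows "(complex_block A B)\<^sup>T = complex_block A\<^sup>T (- B\<^sup>T)"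
  unfolding complex_block_def
  using assms by (intro eq_matI) auto

text \<open>Both products have the parts \<open>A C - B D\<close> and \<open>A D + B C\<close>, up to the order of factors.\<close>
lemma complex_block_commute:
  fixes A B C D :: "'a::comm_ring_1 mat"
  assumes carr: "A \<in> carrier_mat n n" "B \<in> carrier_mat n n" "C \<in> carrier_mat n n" "D \<in> carrier_mat n n"
    and comm: "A * C = C * A" "A * D = D * A" "B * C = C * B" "B * D = D * B"
  shows "complex_block A B * complex_block C D = complex_block C D * complex_block A B"
  using carr comm
  by (simp add: complex_block_mult comm_add_mat[of _ n n])

text \<open>
  The transpose plays the role of complex conjugation, so this is \<open>\<bar>A + i B\<bar>\<^sup>2\<close>; the hypothesis
  removes the imaginary part \<open>B A\<^sup>T - A B\<^sup>T\<close>.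
\<close>
lemma complex_block_mult_transpose:
  fixes A B :: "'a::comm_ring_1 mat"
  assumes carr: "A \<in> carrier_mat n n" "B \<in> carrier_mat n n"
    and sym: "A * B\<^sup>T - B * A\<^sup>T = 0\<^sub>m n n"
  shows "complex_block A B * (complex_block A B)\<^sup>T = complex_block (A * A\<^sup>T + B * B\<^sup>T) (0\<^sub>m n n)"
proof -
  have "A * (- B\<^sup>T) + B * A\<^sup>T = - (A * B\<^sup>T - B * A\<^sup>T)"
    using carr by (intro eq_matI) auto
  also have "\<dots> = 0\<^sub>m n n"
    unfolding sym by (intro eq_matI) auto
  finally have "A * (- B\<^sup>T) + B * A\<^sup>T = 0\<^sub>m n n" .
  moreover have "A * A\<^sup>T - B * (- B\<^sup>T) = A * A\<^sup>T + B * B\<^sup>T"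
    using carr by (intro eq_matI) auto
  ultimately show ?thesis
    using carr by (simp add: transpose_complex_block complex_block_mult[of _ n])
qed

text \<open>
  \<open>X\<close> is the matrix form of a quaternion with complex coordinates \<open>P\<close> and \<open>Q\<close>. The off-diagonal
  blocks of \<open>X X\<^sup>T\<close> are the commutator of \<open>P\<close> and \<open>Q\<close> and its transpose; the diagonal blocks
  are \<open>P P\<^sup>T + Q Q\<^sup>T\<close> and \<open>Q\<^sup>T Q + P\<^sup>T P\<close>, which agree by normality.
\<close>
lemma quaternion_block_orthogonal:
  fixes P Q :: "'a::comm_ring_1 mat"
  assumes P: "P \<in> carrier_mat m m" and Q: "Q \<in> carrier_mat m m"
    and comm: "P * Q = Q * P"
    and normal: "P * P\<^sup>T = P\<^sup>T * P" "Q * Q\<^sup>T = Q\<^sup>T * Q"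
    and norm: "P * P\<^sup>T + Q * Q\<^sup>T = - 1\<^sub>m m"
  defines "X \<equiv> four_block_mat P Q (- Q\<^sup>T) P\<^sup>T"
  shows "X * X\<^sup>T = - 1\<^sub>m (m + m)"
proof -
  have "X\<^sup>T = four_block_mat P\<^sup>T (- Q) Q\<^sup>T P"
    using P Q by (simp add: X_def transpose_four_block_mat[of _ m m _ m _ m] transpose_uminus)
  then have "X * X\<^sup>T = four_block_mat
      (P * P\<^sup>T + Q * Q\<^sup>T) (P * (- Q) + Q * P)
      (- Q\<^sup>T * P\<^sup>T + P\<^sup>T * Q\<^sup>T) (- Q\<^sup>T * (- Q) + P\<^sup>T * P)"
    using P Q unfolding X_def by (simp add: mult_four_block_mat[of _ m m _ m _ m _ _ m _ m])
  also have "P * (- Q) + Q * P = 0\<^sub>m m m"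
    using P Q comm by (simp add: uminus_l_inv_mat[of _ m m])
  also have "- Q\<^sup>T * P\<^sup>T + P\<^sup>T * Q\<^sup>T = 0\<^sub>m m m"
    using P Q arg_cong[OF comm, of transpose_mat]
    by (simp add: transpose_mult[of _ m m _ m] uminus_l_inv_mat[of _ m m])
  also have "- Q\<^sup>T * (- Q) + P\<^sup>T * P = - 1\<^sub>m m"
    using P Q norm normal by (simp add: comm_add_mat[of _ m m])
  finally show ?thesis
    unfolding norm by (auto intro!: eq_matI)
qed

section \<open>The four-circulant construction\<close>

theorem corollary3p2:
  fixes A B C D :: "'a::comm_ring_1 mat" and l :: 'a and n :: nat
  assumes "finite_frobenius_cring (class_ring :: 'a ring)"
    and "n > 0"
    and "l ^ 2 = 1"
    and "circulant l n A" and "circulant l n B" and "circulant l n C" and "circulant l n D"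
    and "A * A\<^sup>T + B * B\<^sup>T + C * C\<^sup>T + D * D\<^sup>T = - 1\<^sub>m n"
    and "A * B\<^sup>T - B * A\<^sup>T = 0\<^sub>m n n"
    and "C * D\<^sup>T - D * C\<^sup>T = 0\<^sub>m n n"
  shows "self_dual (8 * n) (generated_code (generator_matrix n A B C D))"
proof -
  have carr: "A \<in> carrier_mat n n" "B \<in> carrier_mat n n" "C \<in> carrier_mat n n" "D \<in> carrier_mat n n"
    using assms(4-7) by (auto simp: circulant_def)
  note comm = circulants_commute[OF assms(2,3)]
  define P Q where "P = complex_block A B" and "Q = complex_block C D"
  have P: "P \<in> carrier_mat (n + n) (n + n)" and Q: "Q \<in> carrier_mat (n + n) (n + n)"
    using carr by (auto simp: P_def Q_def complex_block_carrier)
  have normal: "complex_block E F * (complex_block E F)\<^sup>T = (complex_block E F)\<^sup>T * complex_block E F"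
    if "circulant l n E" "circulant l n F" for E F
  proof -
    have "E \<in> carrier_mat n n" "F \<in> carrier_mat n n"
      using that by (auto simp: circulant_def)
    then show ?thesis
      using comm(2)[OF that(1) that(1)] comm(2)[OF that(1) that(2)]
        comm(2)[OF that(2) that(1)] comm(2)[OF that(2) that(2)]
      by (simp add: transpose_complex_block complex_block_commute)
  qed
  have "P * Q = Q * P"
    unfolding P_def Q_def using carr assms(4-7) by (intro complex_block_commute comm(1))
  moreover have "P * P\<^sup>T = P\<^sup>T * P" "Q * Q\<^sup>T = Q\<^sup>T * Q"
    unfolding P_def Q_def using assms(4-7) by (simp_all add: normal)
  moreover have "P * P\<^sup>T + Q * Q\<^sup>T = - 1\<^sub>m (n + n)"
  proof -
    have "P * P\<^sup>T + Q * Q\<^sup>T = complex_block (A * A\<^sup>T + B * B\<^sup>T + (C * C\<^sup>T + D * D\<^sup>T)) (0\<^sub>m n n)"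
      unfolding P_def Q_def using carr assms(9,10)
      by (simp add: complex_block_mult_transpose complex_block_add[of _ n])
    also have "A * A\<^sup>T + B * B\<^sup>T + (C * C\<^sup>T + D * D\<^sup>T) = - 1\<^sub>m n"
      using carr assms(8) by (simp add: assoc_add_mat[of _ n n])
    finally show ?thesis
      by (auto intro!: eq_matI simp: complex_block_def)
  qed
  ultimately have "four_block_mat P Q (- Q\<^sup>T) P\<^sup>T * (four_block_mat P Q (- Q\<^sup>T) P\<^sup>T)\<^sup>T
      = - 1\<^sub>m (n + n + (n + n))"
    using quaternion_block_orthogonal[OF P Q] by simp
  then have "self_dual (2 * (n + n + (n + n)))
      (generated_code (append_cols (1\<^sub>m (n + n + (n + n))) (four_block_mat P Q (- Q\<^sup>T) P\<^sup>T)))"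
    using P Q by (intro self_dual_standard_form) simp_all
  moreover have "generator_matrix n A B C D
      = append_cols (1\<^sub>m (n + n + (n + n))) (four_block_mat P Q (- Q\<^sup>T) P\<^sup>T)"
  proof -
    have "- Q\<^sup>T = four_block_mat (- C\<^sup>T) (D\<^sup>T) (- D\<^sup>T) (- C\<^sup>T)"
      using carr unfolding Q_def complex_block_def by (intro eq_matI) auto
    moreover have "P\<^sup>T = four_block_mat (A\<^sup>T) (- B\<^sup>T) (B\<^sup>T) (A\<^sup>T)"
      using carr unfolding P_def complex_block_def by (intro eq_matI) auto
    ultimately show ?thesis
      by (simp add: generator_matrix_def P_def Q_def complex_block_def numeral_eq_Suc algebra_simps)
  qed
  moreover have "2 * (n + n + (n + n)) = 8 * n"
    by simp
  ultimately show ?thesis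
    by metis
qed

end
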